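(* Let $P=(p_{ij})$ be an irreducible sub-stochastic transition matrix on $X=\mathbb{N}=\{1,2,\dots\}$ with $p_{ij}=0$ whenever $j-i\geq2$, and with $\sum_{j\geq1}p_{ij}<1$ for some $i\geq1$. Let $\Phi$ be the corresponding Markov chain, and let $\sigma_3,\sigma_4\in[0,\infty]$ be as defined in the context. Then: (1) The chain $\Phi$ is strongly geometric transient if $\sigma_3<\infty$. (2) The chain $\Phi$ is uniformly geometric transient if and only if $\sigma_4<\infty$.
   Context: Let $\widehat P=(\widehat p_{ij})$ be the stochastic matrix on $\widehat X=\{0\}\cup\mathbb{N}$ with $\widehat p_{ij}=p_{ij}$ for $i,j\geq1$, $\widehat p_{i0}=1-\sum_{j\geq1}p_{ij}$ for $i\geq1$, $\widehat p_{00}=1$ and $\widehat p_{0j}=0$ for $j\ge1$ (so $0$ is absorbing). For $0\leq i<n$ put $p_n^{(i)}=\sum_{k=0}^{i}\widehat p_{nk}$, and define inductively $F_n^{(n)}=1$ (for $n\ge 0$) and $F_n^{(i)}=\sum_{k=i}^{n-1}\frac{p_n^{(k)}F_k^{(i)}}{p_{n,n+1}}$ for $0\le i<n$ (irreducibility gives $p_{n,n+1}>0$ for $n\ge1$). Define $$d_0=0,\qquad d_i=\sum_{k=1}^{i}\frac{F_i^{(k)}}{p_{k,k+1}}\ (i\ge1),\qquad d=\sup_{i\geq1}\frac{\sum_{j=0}^{i-1}d_j}{\sum_{j=0}^{i-1}F_j^{(0)}},$$ $$\sigma_3=\sup_{n\geq1}\ \sum_{k=0}^{n-1}F_k^{(0)}\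 \sum_{j=n}^{\infty}\frac{1}{p_{j,j+1}F_j^{(0)}},\qquad \sigma_4=\sup_{n\geq0}\sum_{k=0}^{n}\left(F_k^{(0)}d-d_k\right),$$ where $\sigma_3$ involves the product of the two sums, $1/0=+\infty$, and $\sigma_4=+\infty$ if $d=\infty$. Write $P^n(i,X)=\sum_{j\ge1}p^{(n)}_{ij}$. The chain is strongly geometric transient if there exists a constant $\kappa>1$ such that $\sum_{n=1}^{\infty}\kappa^nP^n(i,X)<\infty$ for all $i\in X$. It is uniformly geometric transient if there exists a constant $\kappa>1$ such that $\sup_{i\in X}\sum_{n=1}^{\infty}\kappa^nP^n(i,X)<\infty$. *)

theory Defs
  imports "HOL-Analysis.Analysis"
begin

text \<open>
  The state space \<open>X = {1, 2, ...}\<close> is the subset \<open>{1..}\<close> of \<^typ>\<open>nat\<close>. A transition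
  matrix on it is a function \<open>p :: nat \<Rightarrow> nat \<Rightarrow> real\<close> whose values with an index \<open>0\<close> are
  irrelevant: rows and columns are only ever used with indices in \<open>{1..}\<close>.
\<close>

definition substochastic :: "(nat \<Rightarrow> nat \<Rightarrow> real) \<Rightarrow> bool" where
  "substochastic p \<longleftrightarrow>
     (\<forall>i\<ge>1. (\<forall>j\<ge>1. 0 \<le> p i j) \<and> p i summable_on {1..} \<and> (\<Sum>\<^sub>\<infinity>j\<in>{1..}. p i j) \<le> 1)"

text \<open>
  Sums over infinite index sets of nonnegative terms are taken in \<^typ>\<open>ennreal\<close>, where they
  always exist and divergence is the value \<open>\<infinity>\<close>.
\<close>

primrec nstep :: "(nat \<Rightarrow> nat \<Rightarrow> real) \<Rightarrow> nat \<Rightarrow> nat \<Rightarrow> nat \<Rightarrow> ennreal" where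
  "nstep p 0 i j = (if i = j then 1 else 0)"
| "nstep p (Suc n) i j = (\<Sum>\<^sub>\<infinity>k\<in>{1..}. ennreal (p i k) * nstep p n k j)"

definition irreducible_matrix :: "(nat \<Rightarrow> nat \<Rightarrow> real) \<Rightarrow> bool" where
  "irreducible_matrix p \<longleftrightarrow> (\<forall>i\<ge>1. \<forall>j\<ge>1. \<exists>n\<ge>1. nstep p n i j > 0)"

text \<open>\<open>P\<^sup>n(i, X)\<close>, the probability that the chain started in \<open>i\<close> is still in \<open>X\<close> at time \<open>n\<close>.\<close>

definition survival :: "(nat \<Rightarrow> nat \<Rightarrow> real) \<Rightarrow> nat \<Rightarrow> nat \<Rightarrow> ennreal" where
  "survival p n i = (\<Sum>\<^sub>\<infinity>j\<in>{1..}. nstep p n i j)"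

definition strongly_geometric_transient :: "(nat \<Rightarrow> nat \<Rightarrow> real) \<Rightarrow> bool" where
  "strongly_geometric_transient p \<longleftrightarrow>
     (\<exists>\<kappa>::real. \<kappa> > 1 \<and>
        (\<forall>i\<ge>1. (\<Sum>\<^sub>\<infinity>n\<in>{1..}. ennreal (\<kappa> ^ n) * survival p n i) < \<infinity>))"

definition uniformly_geometric_transient :: "(nat \<Rightarrow> nat \<Rightarrow> real) \<Rightarrow> bool" where
  "uniformly_geometric_transient p \<longleftrightarrow>
     (\<exists>\<kappa>::real. \<kappa> > 1 \<and>
        (SUP i\<in>{1..}. \<Sum>\<^sub>\<infinity>n\<in>{1..}. ennreal (\<kappa> ^ n) * survival p n i) < \<infinity>)"

definition phat :: "(nat \<Rightarrow> nat \<Rightarrow> real) \<Rightarrow> nat \<Rightarrow> nat \<Rightarrow> real" where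
  "phat p i j =
     (if i = 0 then (if j = 0 then 1 else 0)
      else if j = 0 then 1 - (\<Sum>\<^sub>\<infinity>k\<in>{1..}. p i k)
      else p i j)"

text \<open>\<open>pcum p n i\<close> is \<open>p\<^sub>n\<close> with upper index \<open>(i)\<close>, meaningful for \<open>i < n\<close>.\<close>

definition pcum :: "(nat \<Rightarrow> nat \<Rightarrow> real) \<Rightarrow> nat \<Rightarrow> nat \<Rightarrow> real" where
  "pcum p n i = (\<Sum>k\<le>i. phat p n k)"

text \<open>
  \<open>F p n i\<close> is \<open>F\<^sub>n\<close> with upper index \<open>(i)\<close>; for \<open>n < i\<close> (a case that is never used)
  the sum is empty and the value is \<open>0\<close>.
\<close>

fun F :: "(nat \<Rightarrow> nat \<Rightarrow> real) \<Rightarrow> nat \<Rightarrow> nat \<Rightarrow> real" where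
  "F p n i =
     (if n = i then 1 else (\<Sum>k\<in>{i..<n}. pcum p n k * F p k i / p n (Suc n)))"

declare F.simps [simp del]

text \<open>The value at \<open>0\<close> is the empty sum \<open>0\<close>.\<close>

definition dseq :: "(nat \<Rightarrow> nat \<Rightarrow> real) \<Rightarrow> nat \<Rightarrow> real" where
  "dseq p i = (\<Sum>k\<in>{1..i}. F p i k / p k (Suc k))"

definition dsup :: "(nat \<Rightarrow> nat \<Rightarrow> real) \<Rightarrow> ereal" where
  "dsup p = (SUP i\<in>{1..}. ereal ((\<Sum>j<i. dseq p j) / (\<Sum>j<i. F p j 0)))"

text \<open>The division is that of \<^typ>\<open>ennreal\<close>, so that \<open>1 / 0 = \<infinity>\<close>.\<close>

definition sigma3 :: "(nat \<Rightarrow> nat \<Rightarrow> real) \<Rightarrow> ennreal" where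
  "sigma3 p =
     (SUP n\<in>{1..}. ennreal (\<Sum>k<n. F p k 0) *
        (\<Sum>\<^sub>\<infinity>j\<in>{n..}. 1 / ennreal (p j (Suc j) * F p j 0)))"

definition sigma4 :: "(nat \<Rightarrow> nat \<Rightarrow> real) \<Rightarrow> ereal" where
  "sigma4 p =
     (if dsup p = \<infinity> then \<infinity>
      else (SUP n. ereal (\<Sum>k\<le>n. F p k 0 * real_of_ereal (dsup p) - dseq p k)))"

end

theory Submission
  imports Defs
begin

text \<open>
  Write \<open>h i = F\<^sub>0 + \<dots> + F\<^bsub>i-1\<^esub>\<close> (upper index \<open>0\<close>) and \<open>g i = d\<^sub>0 + \<dots> + d\<^bsub>i-1\<^esub>\<close>. Abel
  summation shows that \<open>P h = h\<close> and \<open>P g = g + 1\<close> on \<open>X\<close>; since \<open>P\<close> moves up by at most one, the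
  solutions of \<open>y = 1 + P y\<close> with \<open>y 0 = 0\<close> are exactly the functions \<open>c h - g\<close>. So
  \<open>\<sigma>\<^sub>4\<close> is the supremum of the least nonnegative solution \<open>d h - g\<close>, the mean absorption time.
  If it is a finite \<open>M\<close>, then \<open>P y \<le> (1 - 1 / M) y\<close> for \<open>y = d h - g \<ge> 1\<close>, which gives a
  uniform geometric rate; conversely uniform geometric transience bounds the mean absorption time.

  For \<open>\<sigma>\<^sub>3\<close>, put \<open>\<mu>\<^sub>j = 1 / (p\<^bsub>j,j+1\<^esub> F\<^sub>j)\<close>. If \<open>w\<close> is decreasing and \<open>f\<close> has increments
  \<open>F\<^sub>k w\<^sub>k\<close>, then \<open>P f - f \<le> (w\<^sub>n - w\<^bsub>n-1\<^esub>) / \<mu>\<^sub>n\<close> at \<open>n\<close>. With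
  \<open>w\<^sub>k\<close> the tail sum of \<open>\<mu>\<^sub>j sqrt (h j)\<close> over \<open>j > k\<close>, the right-hand side is \<open>- sqrt (h n)\<close>,
  and Hardy's inequality gives \<open>f \<le> 4 \<sigma>\<^sub>3 sqrt h\<close>, so \<open>f\<close> contracts geometrically.
\<close>

section \<open>Sums in \<open>ennreal\<close>\<close>

lemma summable_on_ennreal_total:
  fixes f :: "'a \<Rightarrow> ennreal"
  shows "f summable_on A"
  by (rule nonneg_summable_on_complete) simp

lemma sum_le_infsum_ennreal:
  fixes f :: "'a \<Rightarrow> ennreal"
  assumes "finite B" "B \<subseteq> A"
  shows "sum f B \<le> infsum f A"
proof -
  have "sum f B = infsum f B"
    using assms(1) by simp
  also have "\<dots> \<le> infsum f A"
    by (rule infsum_mono_neutral) (use assms(2) in \<open>auto intro: summable_on_ennreal_total\<close>)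
  finally show ?thesis .
qed

lemma infsum_cmult_right_ennreal:
  fixes f :: "'a \<Rightarrow> ennreal"
  shows "infsum (\<lambda>x. c * f x) A = c * infsum f A"
  by (simp add: nonneg_infsum_complete SUP_mult_left_ennreal flip: sum_distrib_left)

lemma infsum_sum_ennreal:
  fixes f :: "'a \<Rightarrow> 'b \<Rightarrow> ennreal"
  assumes "finite B"
  shows "infsum (\<lambda>x. \<Sum>y\<in>B. f x y) A = (\<Sum>y\<in>B. infsum (\<lambda>x. f x y) A)"
  using assms by (induction B rule: finite_induct) (simp_all add: infsum_add summable_on_ennreal_total)

section \<open>Potentials, finite rows and survival probabilities\<close>

definition hsum :: "(nat \<Rightarrow> nat \<Rightarrow> real) \<Rightarrow> nat \<Rightarrow> real" where
  "hsum p i = (\<Sum>j<i. F p j 0)"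

definition gsum :: "(nat \<Rightarrow> nat \<Rightarrow> real) \<Rightarrow> nat \<Rightarrow> real" where
  "gsum p i = (\<Sum>j<i. dseq p j)"

text \<open>First-step recursion for the survival probability in the reals. Row \<open>i\<close>
  vanishes beyond column \<open>Suc i\<close>, so a finite sum suffices; \<open>survival_eq\<close>
  links it to \<open>survival\<close>.\<close>

primrec surv :: "(nat \<Rightarrow> nat \<Rightarrow> real) \<Rightarrow> nat \<Rightarrow> nat \<Rightarrow> real" where
  "surv p 0 i = 1"
| "surv p (Suc n) i = (\<Sum>k\<in>{1..Suc i}. p i k * surv p n k)"

locale single_birth =
  fixes p :: "nat \<Rightarrow> nat \<Rightarrow> real"
  assumes sub: "substochastic p"
    and irr: "irreducible_matrix p"
    and skip_free: "\<And>i j. 1 \<le> i \<Longrightarrow> i + 2 \<le> j \<Longrightarrow> p i j = 0"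
begin

lemma p_nonneg: "1 \<le> i \<Longrightarrow> 1 \<le> j \<Longrightarrow> 0 \<le> p i j"
  using sub by (auto simp: substochastic_def)

lemma row_infsum:
  assumes "1 \<le> i"
  shows "(\<Sum>\<^sub>\<infinity>k\<in>{1..}. p i k) = (\<Sum>k\<in>{1..Suc i}. p i k)"
proof -
  have "(\<Sum>\<^sub>\<infinity>k\<in>{1..}. p i k) = (\<Sum>\<^sub>\<infinity>k\<in>{1..Suc i}. p i k)"
    by (rule infsum_cong_neutral) (use assms skip_free in auto)
  then show ?thesis by simp
qed

lemma row_sum_le_1: "1 \<le> i \<Longrightarrow> (\<Sum>k\<in>{1..Suc i}. p i k) \<le> 1"
  using sub row_infsum[of i] by (auto simp: substochastic_def)

lemma nstep_Suc:
  assumes "1 \<le> i"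
  shows "nstep p (Suc n) i j = (\<Sum>k\<in>{1..Suc i}. ennreal (p i k) * nstep p n k j)"
proof -
  have "nstep p (Suc n) i j = (\<Sum>\<^sub>\<infinity>k\<in>{1..Suc i}. ennreal (p i k) * nstep p n k j)"
    unfolding nstep.simps by (rule infsum_cong_neutral) (use assms skip_free in auto)
  then show ?thesis by simp
qed

lemma surv_nonneg: "1 \<le> i \<Longrightarrow> 0 \<le> surv p n i"
proof (induction n arbitrary: i)
  case (Suc n)
  then show ?case
    unfolding surv.simps by (intro sum_nonneg mult_nonneg_nonneg p_nonneg) auto
qed simp

lemma survival_eq: "1 \<le> i \<Longrightarrow> survival p n i = ennreal (surv p n i)"
proof (induction n arbitrary: i)
  case 0
  have "survival p 0 i = (\<Sum>\<^sub>\<infinity>j\<in>{i}. 1)"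
    unfolding survival_def nstep.simps by (rule infsum_cong_neutral) (use 0 in auto)
  then show ?case by simp
next
  case (Suc n)
  have "survival p (Suc n) i = (\<Sum>k\<in>{1..Suc i}. ennreal (p i k) * survival p n k)"
    unfolding survival_def nstep_Suc[OF Suc.prems]
    by (simp only: infsum_sum_ennreal[OF finite_atLeastAtMost] infsum_cmult_right_ennreal)
  also have "\<dots> = (\<Sum>k\<in>{1..Suc i}. ennreal (p i k * surv p n k))"
    by (rule sum.cong) (use Suc in \<open>auto simp: ennreal_mult p_nonneg surv_nonneg\<close>)
  also have "\<dots> = ennreal (surv p (Suc n) i)"
    unfolding surv.simps
    by (rule sum_ennreal) (use Suc.prems in \<open>auto intro!: mult_nonneg_nonneg p_nonneg surv_nonneg\<close>)
  finally show ?case .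
qed

text \<open>Only \<open>i\<close> itself can jump from \<open>{1..i}\<close> to
  \<open>Suc i\<close>. If that jump had probability zero, \<open>Suc i\<close> would be unreachable
  from \<open>{1..i}\<close>, contradicting irreducibility.\<close>

lemma p_up_pos:
  assumes "1 \<le> i"
  shows "0 < p i (Suc i)"
proof (rule ccontr)
  assume "\<not> 0 < p i (Suc i)"
  then have up0: "p i (Suc i) = 0"
    using p_nonneg[of i "Suc i"] assms by auto
  have "nstep p n k (Suc i) = 0" if "1 \<le> k" "k \<le> i" for n k
    using that
  proof (induction n arbitrary: k)
    case (Suc n)
    have "ennreal (p k l) * nstep p n l (Suc i) = 0" if "l \<in> {1..Suc k}" for l
    proof (cases "l \<le> i")
      case True
      then show ?thesis using Suc.IH[of l] that by auto
    next
      case False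
      then have "l = Suc i" "k = i" using that Suc.prems by auto
      then show ?thesis using up0 by simp
    qed
    then show ?case
      unfolding nstep_Suc[OF Suc.prems(1)] by (intro sum.neutral) blast
  qed simp
  then show False
    using irr assms unfolding irreducible_matrix_def
    by (metis le_Suc_eq le_refl less_irrefl)
qed

section \<open>The completed matrix and the drift of a function\<close>

lemma phat_nonneg: "1 \<le> n \<Longrightarrow> 0 \<le> phat p n k"
  using row_sum_le_1[of n] row_infsum[of n] p_nonneg[of n k] by (auto simp: phat_def)

lemma phat_row_sum:
  assumes "1 \<le> n"
  shows "(\<Sum>k<Suc (Suc n). phat p n k) = 1"
proof -
  have "{..<Suc (Suc n)} = insert 0 {1..Suc n}" by auto
  then have "(\<Sum>k<Suc (Suc n). phat p n k) = phat p n 0 + (\<Sum>k\<in>{1..Suc n}. phat p n k)"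
    by simp
  also have "(\<Sum>k\<in>{1..Suc n}. phat p n k) = (\<Sum>k\<in>{1..Suc n}. p n k)"
    by (rule sum.cong) (use assms in \<open>auto simp: phat_def\<close>)
  finally show ?thesis
    using assms row_infsum[OF assms] by (simp add: phat_def)
qed

lemma pcum_nonneg: "1 \<le> n \<Longrightarrow> 0 \<le> pcum p n j"
  unfolding pcum_def by (intro sum_nonneg phat_nonneg)

text \<open>Abel summation: \<open>pcum p n\<close> is the sequence of partial sums of
  \<open>phat p n\<close>.\<close>

lemma sum_pcum_diff:
  "(\<Sum>j<m. pcum p n j * (f (Suc j) - f j)) =
     (\<Sum>k<m. phat p n k) * f m - (\<Sum>k<m. phat p n k * f k)"
  by (induction m) (simp_all add: pcum_def lessThan_Suc_atMost[symmetric] algebra_simps)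

text \<open>Since \<open>f 0 = 0\<close>, the absorbing state contributes nothing and
  \<open>phat\<close> may replace \<open>p\<close>. Abel summation together with row sum 1 then
  expresses the drift through the increments of \<open>f\<close> alone.\<close>

lemma drift:
  assumes "1 \<le> n" "f 0 = 0"
  shows "(\<Sum>k\<in>{1..Suc n}. p n k * f k) - f n =
    p n (Suc n) * (f (Suc n) - f n) - (\<Sum>j<n. pcum p n j * (f (Suc j) - f j))"
proof -
  have "{..<Suc (Suc n)} = insert 0 {1..Suc n}" by auto
  then have "(\<Sum>k<Suc (Suc n). phat p n k * f k) = (\<Sum>k\<in>{1..Suc n}. phat p n k * f k)"
    using assms by simp
  also have "\<dots> = (\<Sum>k\<in>{1..Suc n}. p n k * f k)"
    by (rule sum.cong) (use assms in \<open>auto simp: phat_def\<close>)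
  finally have 1: "(\<Sum>k\<in>{1..Suc n}. p n k * f k) =
      (\<Sum>k<n. phat p n k * f k) + phat p n n * f n + p n (Suc n) * f (Suc n)"
    using assms by (simp add: phat_def)
  have 2: "(\<Sum>k<n. phat p n k) = 1 - phat p n n - p n (Suc n)"
    using phat_row_sum[OF assms(1)] assms(1) by (simp add: phat_def)
  show ?thesis
    unfolding sum_pcum_diff 1 2 by (simp add: algebra_simps)
qed

section \<open>Recursions for F and d\<close>

lemma F_rec: "i < n \<Longrightarrow> 1 \<le> n \<Longrightarrow> p n (Suc n) * F p n i = (\<Sum>k\<in>{i..<n}. pcum p n k * F p k i)"
  using p_up_pos[of n] by (subst F.simps) (simp flip: sum_divide_distrib)

lemma F_diag: "F p n n = 1"
  by (subst F.simps) simp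

lemma F_nonneg: "0 \<le> F p n i"
proof (induction n rule: less_induct)
  case (less n)
  show ?case
  proof (cases "n \<le> i")
    case True
    then show ?thesis by (subst F.simps) simp
  next
    case False
    then show ?thesis
      using less.IH p_nonneg[of n "Suc n"]
      by (subst F.simps) (auto intro!: sum_nonneg divide_nonneg_nonneg mult_nonneg_nonneg pcum_nonneg)
  qed
qed

lemma F0_rec: "1 \<le> n \<Longrightarrow> p n (Suc n) * F p n 0 = (\<Sum>j<n. pcum p n j * F p j 0)"
  using F_rec[of 0 n] by (simp add: atLeast0LessThan)

lemma dseq_nonneg: "0 \<le> dseq p n"
  unfolding dseq_def by (intro sum_nonneg divide_nonneg_nonneg F_nonneg p_nonneg) auto

text \<open>Exchanging the sums over the triangle \<open>k \<le> j < n\<close> lets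
  \<open>F_rec\<close> collapse the inner sum for each \<open>k < n\<close>. The diagonal term
  \<open>k = n\<close> of \<open>dseq p n\<close> supplies the 1.\<close>

lemma dseq_rec:
  assumes "1 \<le> n"
  shows "p n (Suc n) * dseq p n = 1 + (\<Sum>j<n. pcum p n j * dseq p j)"
proof -
  have "(\<Sum>j<n. pcum p n j * dseq p j) =
      (\<Sum>j<n. \<Sum>k | k \<in> {1..<n} \<and> k \<le> j. pcum p n j * F p j k / p k (Suc k))"
    unfolding dseq_def sum_distrib_left by (intro sum.cong) auto
  also have "\<dots> = (\<Sum>k\<in>{1..<n}. \<Sum>j | j \<in> {..<n} \<and> k \<le> j. pcum p n j * F p j k / p k (Suc k))"
    by (rule sum.swap_restrict) auto
  also have "\<dots> = (\<Sum>k\<in>{1..<n}. p n (Suc n) * F p n k / p k (Suc k))"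
  proof (rule sum.cong[OF refl])
    fix k assume k: "k \<in> {1..<n}"
    have "{j. j \<in> {..<n} \<and> k \<le> j} = {k..<n}" by auto
    then show "(\<Sum>j | j \<in> {..<n} \<and> k \<le> j. pcum p n j * F p j k / p k (Suc k)) =
        p n (Suc n) * F p n k / p k (Suc k)"
      using F_rec[of k n] k by (simp flip: sum_divide_distrib)
  qed
  finally have *: "(\<Sum>j<n. pcum p n j * dseq p j) = \<dots>" .
  have "{1..n} = insert n {1..<n}" using assms by auto
  then have "dseq p n = 1 / p n (Suc n) + (\<Sum>k\<in>{1..<n}. F p n k / p k (Suc k))"
    unfolding dseq_def by (simp add: F_diag)
  then show ?thesis
    using p_up_pos[OF assms] unfolding * by (simp add: distrib_left sum_distrib_left)
qed

section \<open>The Poisson equation\<close>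

lemma hsum_0: "hsum p 0 = 0" and hsum_Suc: "hsum p (Suc n) = hsum p n + F p n 0"
  and gsum_0: "gsum p 0 = 0" and gsum_Suc: "gsum p (Suc n) = gsum p n + dseq p n"
  by (simp_all add: hsum_def gsum_def)

lemma hsum_ge_1: "1 \<le> n \<Longrightarrow> 1 \<le> hsum p n"
proof (induction n rule: dec_induct)
  case base
  then show ?case by (simp add: hsum_def F_diag)
next
  case (step n)
  then show ?case using F_nonneg[of n 0] by (simp add: hsum_Suc)
qed

lemma gsum_nonneg: "0 \<le> gsum p n"
  unfolding gsum_def by (intro sum_nonneg dseq_nonneg)

lemma poisson_hsum_gsum:
  assumes "1 \<le> n"
  shows "(\<Sum>k\<in>{1..Suc n}. p n k * (c * hsum p k - gsum p k)) = c * hsum p n - gsum p n - 1"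
proof -
  have "(\<Sum>j<n. pcum p n j * (c * F p j 0 - dseq p j)) =
      c * (\<Sum>j<n. pcum p n j * F p j 0) - (\<Sum>j<n. pcum p n j * dseq p j)"
    by (simp add: algebra_simps sum_subtractf sum_distrib_left)
  also have "\<dots> = p n (Suc n) * (c * F p n 0 - dseq p n) + 1"
    using F0_rec[OF assms] dseq_rec[OF assms] by (simp add: algebra_simps)
  finally show ?thesis
    using drift[OF assms, of "\<lambda>k. c * hsum p k - gsum p k"]
    by (simp add: hsum_0 gsum_0 hsum_Suc gsum_Suc algebra_simps)
qed

text \<open>By \<open>drift\<close> and \<open>p_up_pos\<close>, the increment of \<open>T\<close>
  at \<open>n\<close> is determined by the earlier ones, so \<open>T 1\<close> is the only free
  parameter. It is the increment at 0, where F is 1 and d is 0.\<close>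

lemma poisson_unique:
  assumes T0: "T 0 = 0"
    and T: "\<And>n. 1 \<le> n \<Longrightarrow> (\<Sum>k\<in>{1..Suc n}. p n k * T k) = T n - 1"
  shows "T n = T 1 * hsum p n - gsum p n"
proof -
  have *: "T (Suc n) - T n = T 1 * F p n 0 - dseq p n" for n
  proof (induction n rule: less_induct)
    case (less n)
    show ?case
    proof (cases "n = 0")
      case True
      then show ?thesis by (simp add: T0 F_diag dseq_def)
    next
      case False
      then have n: "1 \<le> n" by simp
      have "p n (Suc n) * (T (Suc n) - T n) = (\<Sum>j<n. pcum p n j * (T (Suc j) - T j)) - 1"
        using drift[OF n, of T] T[OF n] T0 by simp
      also have "(\<Sum>j<n. pcum p n j * (T (Suc j) - T j)) =
          (\<Sum>j<n. pcum p n j * (T 1 * F p j 0 - dseq p j))"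
        using less.IH by (intro sum.cong) auto
      also have "\<dots> = T 1 * (\<Sum>j<n. pcum p n j * F p j 0) - (\<Sum>j<n. pcum p n j * dseq p j)"
        by (simp add: algebra_simps sum_subtractf sum_distrib_left)
      also have "\<dots> - 1 = p n (Suc n) * (T 1 * F p n 0 - dseq p n)"
        using F0_rec[OF n] dseq_rec[OF n] by (simp add: algebra_simps)
      finally show ?thesis
        using p_up_pos[OF n] by simp
    qed
  qed
  show ?thesis
  proof (induction n)
    case (Suc n)
    then show ?case
      using *[of n] by (simp add: hsum_Suc gsum_Suc distrib_left)
  qed (simp add: T0 hsum_0 gsum_0)
qed

section \<open>Lyapunov functions and geometric decay\<close>

lemma surv_le_lyapunov:
  assumes V: "\<And>i. 1 \<le> i \<Longrightarrow> c \<le> V i" and "0 < c" "0 \<le> r"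
    and PV: "\<And>i. 1 \<le> i \<Longrightarrow> (\<Sum>k\<in>{1..Suc i}. p i k * V k) \<le> r * V i"
  shows "1 \<le> i \<Longrightarrow> surv p n i \<le> r ^ n * V i / c"
proof (induction n arbitrary: i)
  case 0
  then show ?case using V[of i] assms(2) by simp
next
  case (Suc n)
  have "surv p (Suc n) i \<le> (\<Sum>k\<in>{1..Suc i}. p i k * (r ^ n * V k / c))"
    unfolding surv.simps
    by (intro sum_mono mult_left_mono Suc.IH p_nonneg) (use Suc.prems in auto)
  also have "\<dots> = r ^ n / c * (\<Sum>k\<in>{1..Suc i}. p i k * V k)"
    unfolding sum_distrib_left by (rule sum.cong) simp_all
  also have "\<dots> \<le> r ^ n / c * (r * V i)"
    by (intro mult_left_mono PV) (use Suc.prems assms in auto)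
  finally show ?case by (simp add: mult_ac)
qed

text \<open>The drift condition is a contraction by \<open>r = 1 - 1 / C\<close>, so survival decays
  like \<open>r ^ n\<close>, and a geometric series bounds the sum for \<open>\<kappa>\<close>
  slightly above 1. The rate \<open>\<kappa>\<close> does not depend on \<open>i\<close>; only the
  bound does.\<close>

lemma geometric_drift:
  assumes V: "\<And>i. 1 \<le> i \<Longrightarrow> c \<le> V i" and "0 < c" "0 < C"
    and PV: "\<And>i. 1 \<le> i \<Longrightarrow> (\<Sum>k\<in>{1..Suc i}. p i k * V k) \<le> V i - V i / C"
  obtains \<kappa> K :: real where "1 < \<kappa>" "0 \<le> K"
    "\<And>i. 1 \<le> i \<Longrightarrow> (\<Sum>\<^sub>\<infinity>n\<in>{1..}. ennreal (\<kappa> ^ n) * survival p n i) \<le> ennreal (K * V i)"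
proof -
  define r where "r = 1 - 1 / C"
  \<comment> \<open>That \<open>r\<close> is nonnegative does not follow from \<open>0 < C\<close>;
    it comes from the drift condition at state 1, whose left side is nonnegative.\<close>
  have "0 \<le> (\<Sum>k\<in>{1..Suc 1}. p 1 k * V k)"
  proof (intro sum_nonneg mult_nonneg_nonneg p_nonneg)
    fix k assume "k \<in> {1..Suc 1}"
    then show "0 \<le> V k" using V[of k] \<open>0 < c\<close> by auto
  qed auto
  also have "\<dots> \<le> r * V 1"
    using PV[of 1] by (simp add: r_def algebra_simps)
  finally have r0: "0 \<le> r"
    using V[of 1] \<open>0 < c\<close> by (simp add: zero_le_mult_iff)
  have r1: "r < 1" using \<open>0 < C\<close> by (simp add: r_def)
  \<comment> \<open>The reciprocal of the midpoint between \<open>r\<close> and 1, so that both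
    \<open>1 < \<kappa>\<close> and \<open>\<kappa> * r < 1\<close>.\<close>
  define \<kappa> where "\<kappa> = 2 / (1 + r)"
  define q where "q = \<kappa> * r"
  have \<kappa>: "1 < \<kappa>" and q: "0 \<le> q" "q < 1"
    using r0 r1 by (auto simp: \<kappa>_def q_def field_simps)
  have "(\<Sum>\<^sub>\<infinity>n\<in>{1..}. ennreal (\<kappa> ^ n) * survival p n i) \<le> ennreal (1 / (c * (1 - q)) * V i)"
    if i: "1 \<le> i" for i
  proof (rule infsum_le_finite_sums)
    fix N :: "nat set" assume N: "finite N" "N \<subseteq> {1..}"
    have "(\<Sum>n\<in>N. ennreal (\<kappa> ^ n) * survival p n i) = (\<Sum>n\<in>N. ennreal (\<kappa> ^ n * surv p n i))"
      using \<kappa> i by (intro sum.cong) (auto simp: survival_eq ennreal_mult surv_nonneg)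
    also have "\<dots> = ennreal (\<Sum>n\<in>N. \<kappa> ^ n * surv p n i)"
      using \<kappa> i by (intro sum_ennreal) (auto simp: surv_nonneg)
    also have "(\<Sum>n\<in>N. \<kappa> ^ n * surv p n i) \<le> (\<Sum>n\<in>N. V i / c * q ^ n)"
    proof (rule sum_mono)
      fix n
      have "surv p n i \<le> r ^ n * V i / c"
        by (rule surv_le_lyapunov[OF V _ r0 _ i]) (use PV \<open>0 < c\<close> in \<open>auto simp: r_def algebra_simps\<close>)
      then have "\<kappa> ^ n * surv p n i \<le> \<kappa> ^ n * (r ^ n * V i / c)"
        using \<kappa> by (intro mult_left_mono) auto
      then show "\<kappa> ^ n * surv p n i \<le> V i / c * q ^ n"
        by (simp add: q_def power_mult_distrib mult_ac)
    qed
    also have "\<dots> = V i / c * (\<Sum>n\<in>N. q ^ n)"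
      by (simp add: sum_distrib_left)
    also have "\<dots> \<le> V i / c * (1 / (1 - q))"
    proof (rule mult_left_mono)
      have "(\<Sum>n\<in>N. q ^ n) \<le> (\<Sum>n. q ^ n)"
        by (rule sum_le_suminf) (use q N in \<open>auto intro: summable_geometric\<close>)
      then show "(\<Sum>n\<in>N. q ^ n) \<le> 1 / (1 - q)"
        using q by (simp add: suminf_geometric)
      show "0 \<le> V i / c" using V[OF i] \<open>0 < c\<close> by simp
    qed
    finally show "(\<Sum>n\<in>N. ennreal (\<kappa> ^ n) * survival p n i) \<le> ennreal (1 / (c * (1 - q)) * V i)"
      by (simp add: ennreal_leI)
  qed (rule summable_on_ennreal_total)
  then show thesis
    using that[OF \<kappa>, of "1 / (c * (1 - q))"] q \<open>0 < c\<close> by simp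
qed

section \<open>Uniform geometric transience and sigma_4\<close>

lemma uniformly_geometric_transient_if_sigma4:
  assumes "sigma4 p < \<infinity>"
  shows "uniformly_geometric_transient p"
proof -
  have dinf: "dsup p \<noteq> \<infinity>"
    using assms by (auto simp: sigma4_def)
  have le_d: "ereal (gsum p i / hsum p i) \<le> dsup p" if "1 \<le> i" for i
    unfolding dsup_def gsum_def hsum_def by (rule SUP_upper) (use that in auto)
  define d where "d = real_of_ereal (dsup p)"
  have d: "dsup p = ereal d"
    using le_d[of 1] dinf by (cases "dsup p") (auto simp: d_def)
  define y where "y i = d * hsum p i - gsum p i" for i
  have y_pos: "0 \<le> y i" if "1 \<le> i" for i
    using le_d[OF that] hsum_ge_1[OF that] by (simp add: d y_def field_simps)
  have y_eq: "(\<Sum>k\<in>{1..Suc i}. p i k * y k) = y i - 1" if "1 \<le> i" for i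
    unfolding y_def by (rule poisson_hsum_gsum[OF that])
  \<comment> \<open>Nonnegativity of \<open>y\<close>, fed back into the Poisson equation, improves
    to the lower bound 1.\<close>
  have y_ge: "1 \<le> y i" if "1 \<le> i" for i
  proof -
    have "0 \<le> (\<Sum>k\<in>{1..Suc i}. p i k * y k)"
      by (intro sum_nonneg mult_nonneg_nonneg p_nonneg y_pos) (use that in auto)
    then show ?thesis using y_eq[OF that] by simp
  qed
  \<comment> \<open>Index shift: the sum over \<open>k \<le> n\<close> in \<open>sigma4\<close> is
    \<open>y\<close> at \<open>Suc n\<close>.\<close>
  have s4: "ereal (y (Suc n)) \<le> sigma4 p" for n
  proof -
    have "y (Suc n) = (\<Sum>k\<le>n. F p k 0 * d - dseq p k)"
      unfolding y_def hsum_def gsum_def lessThan_Suc_atMost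
      by (simp add: sum_subtractf sum_distrib_left mult.commute)
    then show ?thesis
      using dinf unfolding sigma4_def d_def by (auto intro: SUP_upper)
  qed
  define M where "M = real_of_ereal (sigma4 p)"
  have M: "sigma4 p = ereal M"
    using s4[of 0] assms by (cases "sigma4 p") (auto simp: M_def)
  have y_le: "y i \<le> M" if "1 \<le> i" for i
    using s4[of "i - 1"] that by (simp add: M)
  have M0: "0 < M" using y_ge[of 1] y_le[of 1] by simp
  \<comment> \<open>The constant decrease 1 is at least \<open>y i / M\<close> because
    \<open>y i \<le> M\<close>.\<close>
  have "(\<Sum>k\<in>{1..Suc i}. p i k * y k) \<le> y i - y i / M" if "1 \<le> i" for i
    unfolding y_eq[OF that] using y_le[OF that] M0 by simp
  then obtain \<kappa> K :: real where \<kappa>: "1 < \<kappa>" "0 \<le> K"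
    and bd: "\<And>i. 1 \<le> i \<Longrightarrow> (\<Sum>\<^sub>\<infinity>n\<in>{1..}. ennreal (\<kappa> ^ n) * survival p n i) \<le> ennreal (K * y i)"
    using geometric_drift[of 1 y M] y_ge M0 by auto
  have "(SUP i\<in>{1..}. \<Sum>\<^sub>\<infinity>n\<in>{1..}. ennreal (\<kappa> ^ n) * survival p n i) \<le> ennreal (K * M)"
  proof (rule SUP_least)
    fix i :: nat assume i: "i \<in> {1..}"
    have "K * y i \<le> K * M" using y_le[of i] i \<kappa> by (intro mult_left_mono) auto
    then show "(\<Sum>\<^sub>\<infinity>n\<in>{1..}. ennreal (\<kappa> ^ n) * survival p n i) \<le> ennreal (K * M)"
      using bd[of i] i by (meson atLeast_iff ennreal_leI order_trans)
  qed
  also have "\<dots> < \<infinity>" by simp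
  finally show ?thesis
    unfolding uniformly_geometric_transient_def using \<kappa> by blast
qed

text \<open>The mean absorption time \<open>T\<close> is bounded and solves the Poisson equation, so
  it equals \<open>T 1 * h - g\<close>. Its nonnegativity gives \<open>d \<le> T 1\<close>, whence
  \<open>d * h - g \<le> T\<close>.\<close>

lemma sigma4_if_uniformly_geometric_transient:
  assumes "uniformly_geometric_transient p"
  shows "sigma4 p < \<infinity>"
proof -
  obtain \<kappa> :: real where \<kappa>: "1 < \<kappa>"
    and fin: "(SUP i\<in>{1..}. \<Sum>\<^sub>\<infinity>n\<in>{1..}. ennreal (\<kappa> ^ n) * survival p n i) < \<infinity>" (is "?S < _")
    using assms by (auto simp: uniformly_geometric_transient_def)
  define B where "B = enn2real ?S"
  have B: "?S = ennreal B" "0 \<le> B"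
    using fin by (auto simp: B_def)
  \<comment> \<open>The extra 1 is the term \<open>n = 0\<close>, which the transience sum
    omits.\<close>
  have part: "(\<Sum>n<N. surv p n i) \<le> 1 + B" if i: "1 \<le> i" for i N
  proof -
    have "(\<Sum>n\<in>{1..N}. ennreal (surv p n i)) \<le> (\<Sum>n\<in>{1..N}. ennreal (\<kappa> ^ n) * survival p n i)"
    proof (rule sum_mono)
      fix n
      have "1 * surv p n i \<le> \<kappa> ^ n * surv p n i"
        using \<kappa> i by (intro mult_right_mono surv_nonneg) auto
      then show "ennreal (surv p n i) \<le> ennreal (\<kappa> ^ n) * survival p n i"
        using \<kappa> i by (simp add: survival_eq surv_nonneg ennreal_leI flip: ennreal_mult)
    qed
    also have "\<dots> \<le> (\<Sum>\<^sub>\<infinity>n\<in>{1..}. ennreal (\<kappa> ^ n) * survival p n i)"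
      by (rule sum_le_infsum_ennreal) auto
    also have "\<dots> \<le> ?S"
      by (rule SUP_upper) (use i in auto)
    finally have "(\<Sum>n\<in>{1..N}. surv p n i) \<le> B"
      using B i by (simp add: sum_ennreal surv_nonneg)
    moreover have "(\<Sum>n<N. surv p n i) \<le> (\<Sum>n\<in>insert 0 {1..N}. surv p n i)"
      by (rule sum_mono2) (use i in \<open>auto intro: surv_nonneg\<close>)
    ultimately show ?thesis by simp
  qed
  have summ: "summable (\<lambda>n. surv p n i)" if "1 \<le> i" for i
    by (rule summableI_nonneg_bounded[OF _ part]) (use that surv_nonneg in auto)
  \<comment> \<open>The value at 0 is set by hand: \<open>surv p 0 0\<close> is 1, while
    \<open>poisson_unique\<close> requires \<open>T 0 = 0\<close>.\<close>
  define T where "T i = (if i = 0 then 0 else \<Sum>n. surv p n i)" for i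
  have T_le: "T i \<le> 1 + B" if "1 \<le> i" for i
    using that suminf_le_const[OF summ part] by (auto simp: T_def)
  have T_nonneg: "0 \<le> T i" for i
    using suminf_nonneg[OF summ] surv_nonneg by (auto simp: T_def)
  have "(\<Sum>k\<in>{1..Suc n}. p n k * T k) = T n - 1" if n: "1 \<le> n" for n
  proof -
    have "(\<Sum>k\<in>{1..Suc n}. p n k * T k) = (\<Sum>k\<in>{1..Suc n}. \<Sum>m. p n k * surv p m k)"
      by (intro sum.cong) (auto simp: T_def suminf_mult summ)
    also have "\<dots> = (\<Sum>m. surv p (Suc m) n)"
      unfolding surv.simps by (rule suminf_sum[symmetric]) (auto intro: summable_mult summ)
    also have "\<dots> = T n - 1"
      using suminf_split_head[OF summ[OF n]] n by (simp add: T_def)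
    finally show ?thesis .
  qed
  then have T_eq: "T n = T 1 * hsum p n - gsum p n" for n
    by (intro poisson_unique) (auto simp: T_def)
  have d_le: "dsup p \<le> ereal (T 1)"
    unfolding dsup_def
  proof (rule SUP_least)
    fix i :: nat assume i: "i \<in> {1..}"
    then have "gsum p i / hsum p i \<le> T 1"
      using T_nonneg[of i] T_eq[of i] hsum_ge_1[of i] by (simp add: field_simps)
    then show "ereal ((\<Sum>j<i. dseq p j) / (\<Sum>j<i. F p j 0)) \<le> ereal (T 1)"
      by (simp add: gsum_def hsum_def)
  qed
  \<comment> \<open>This excludes \<open>dsup p = -\<infinity>\<close>.\<close>
  moreover have "ereal (gsum p 1 / hsum p 1) \<le> dsup p"
    unfolding dsup_def gsum_def hsum_def by (rule SUP_upper) auto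
  ultimately obtain d where d: "dsup p = ereal d" "d \<le> T 1"
    by (cases "dsup p") auto
  have "sigma4 p \<le> ereal (1 + B)"
    unfolding sigma4_def d
  proof (simp, rule SUP_least)
    fix n
    have "(\<Sum>k\<le>n. F p k 0 * d - dseq p k) = d * hsum p (Suc n) - gsum p (Suc n)"
      unfolding hsum_def gsum_def lessThan_Suc_atMost
      by (simp add: sum_subtractf sum_distrib_left mult.commute)
    also have "\<dots> \<le> T (Suc n)"
      using d(2) hsum_ge_1[of "Suc n"] T_eq[of "Suc n"] by (simp add: mult_right_mono)
    also have "\<dots> \<le> 1 + B" by (rule T_le) simp
    finally show "ereal (\<Sum>k\<le>n. F p k 0 * d - dseq p k) \<le> ereal (1 + B)" by simp
  qed
  then show ?thesis by auto
qed

end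

section \<open>A Hardy-type tail bound\<close>

lemma hardy_tail:
  fixes h \<mu> :: "nat \<Rightarrow> real"
  assumes h: "\<And>n. 1 \<le> n \<Longrightarrow> 0 < h n" "\<And>n. h n \<le> h (Suc n)"
    and \<mu>: "\<And>n. 1 \<le> n \<Longrightarrow> 0 \<le> \<mu> n"
    and tail: "\<And>n N. 1 \<le> n \<Longrightarrow> h n * (\<Sum>j\<in>{n..<N}. \<mu> j) \<le> S"
    and n: "1 \<le> n"
  shows "(\<Sum>j\<in>{n..<N}. \<mu> j * sqrt (h j)) \<le> 2 * S / sqrt (h n)"
proof (cases "n \<le> N")
  case False
  have "0 \<le> S" using tail[of 1 1] by simp
  then show ?thesis using False h(1)[OF n] by simp
next
  case True
  have S: "0 \<le> S" using tail[of 1 1] by simp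
  define M where "M m = (\<Sum>j\<in>{m..<N}. \<mu> j)" for m
  have M_le: "h m * M m \<le> S" if "1 \<le> m" for m
    unfolding M_def by (rule tail[OF that])
  \<comment> \<open>Summation by parts as an invariant: the left side never increases with
    \<open>m\<close>. The tail hypothesis bounds it at \<open>m = n\<close>; at \<open>m = N\<close>
    the tail \<open>M N\<close> is empty and the last term is dropped.\<close>
  have inv: "(\<Sum>j\<in>{n..<m}. \<mu> j * sqrt (h j)) + M m * sqrt (h m) + S / sqrt (h m) \<le> 2 * S / sqrt (h n)"
    if "n \<le> m" "m \<le> N" for m
    using that
  proof (induction m rule: dec_induct)
    case base
    have "M n * sqrt (h n) \<le> S / sqrt (h n)"
      using M_le[OF n] h(1)[OF n] by (simp add: field_simps)
    then show ?case by simp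
  next
    case (step m)
    define a b where "a = sqrt (h m)" and "b = sqrt (h (Suc m))"
    have m: "1 \<le> m" using step n by simp
    have ab: "0 < a" "a \<le> b" "0 < b" "b * b = h (Suc m)"
      using h(1)[OF m] h(1)[of "Suc m"] h(2)[of m] by (auto simp: a_def b_def)
    have "{m..<N} = insert m {Suc m..<N}" using step by auto
    then have Mm: "M m = \<mu> m + M (Suc m)" by (simp add: M_def)
    \<comment> \<open>The tail is at most \<open>S / (b * b)\<close>. Weakening this to
      \<open>S / (a * b)\<close> makes the bound telescope as \<open>S / a - S / b\<close>.\<close>
    have "M (Suc m) * (b - a) \<le> S / (b * b) * (b - a)"
      using M_le[of "Suc m"] ab h(1)[of "Suc m"]
      by (intro mult_right_mono) (auto simp: field_simps)
    also have "\<dots> \<le> S / (a * b) * (b - a)"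
    proof (rule mult_right_mono)
      show "S / (b * b) \<le> S / (a * b)"
        using ab(1-3) S by (intro divide_left_mono mult_right_mono mult_pos_pos) auto
    qed (use ab in simp)
    also have "\<dots> = S / a - S / b"
      using ab by (simp add: field_simps)
    finally have "\<mu> m * a + M (Suc m) * b + S / b \<le> M m * a + S / a"
      by (simp add: Mm algebra_simps)
    moreover have "(\<Sum>j\<in>{n..<Suc m}. \<mu> j * sqrt (h j)) = (\<Sum>j\<in>{n..<m}. \<mu> j * sqrt (h j)) + \<mu> m * a"
      using step by (simp add: a_def)
    moreover have "(\<Sum>j\<in>{n..<m}. \<mu> j * sqrt (h j)) + M m * a + S / a \<le> 2 * S / sqrt (h n)"
      using step by (simp add: a_def)
    ultimately show ?case unfolding b_def[symmetric] by linarith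
  qed
  have "0 \<le> S / sqrt (h N)" using S h(1)[of N] True n by simp
  then show ?thesis using inv[OF True] by (simp add: M_def)
qed

section \<open>Strong geometric transience from sigma_3\<close>

context single_birth
begin

lemma strongly_geometric_transient_if_sigma3:
  assumes "sigma3 p < \<infinity>"
  shows "strongly_geometric_transient p"
proof -
  define S where "S = enn2real (sigma3 p)"
  have S: "sigma3 p = ennreal S" "0 \<le> S"
    using assms by (auto simp: S_def)
  define \<mu> where "\<mu> j = 1 / (p j (Suc j) * F p j 0)" for j
  have tail_ennreal: "ennreal (hsum p n) * (\<Sum>\<^sub>\<infinity>j\<in>{n..}. 1 / ennreal (p j (Suc j) * F p j 0)) \<le> ennreal S"
    if "1 \<le> n" for n
    unfolding S(1)[symmetric] sigma3_def hsum_def by (rule SUP_upper) (use that in auto)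
  \<comment> \<open>A zero of F would put a term \<open>1 / 0 = \<infinity>\<close> into a tail sum
    whose prefactor is at least 1, making \<open>sigma3\<close> infinite.\<close>
  have F_pos: "0 < F p j 0" if "1 \<le> j" for j
  proof (rule ccontr)
    assume "\<not> 0 < F p j 0"
    then have "F p j 0 = 0" using F_nonneg[of j 0] by simp
    then have "\<infinity> = (\<Sum>i\<in>{j}. 1 / ennreal (p i (Suc i) * F p i 0))"
      by (simp add: ennreal_divide_zero)
    also have "\<dots> \<le> (\<Sum>\<^sub>\<infinity>i\<in>{j..}. 1 / ennreal (p i (Suc i) * F p i 0))"
      by (rule sum_le_infsum_ennreal) auto
    finally have "(\<Sum>\<^sub>\<infinity>i\<in>{j..}. 1 / ennreal (p i (Suc i) * F p i 0)) = \<infinity>"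
      by (simp add: top_unique)
    then show False
      using tail_ennreal[OF that] hsum_ge_1[OF that] by (simp add: ennreal_mult_top top_unique)
  qed
  have \<mu>_pos: "0 < \<mu> j" if "1 \<le> j" for j
    using F_pos[OF that] p_up_pos[OF that] by (simp add: \<mu>_def)
  have tail: "hsum p n * (\<Sum>j\<in>{n..<N}. \<mu> j) \<le> S" if n: "1 \<le> n" for n N
  proof -
    have "ennreal (\<Sum>j\<in>{n..<N}. \<mu> j) = (\<Sum>j\<in>{n..<N}. 1 / ennreal (p j (Suc j) * F p j 0))"
    proof (subst sum_ennreal[symmetric])
      show "(\<Sum>j\<in>{n..<N}. ennreal (\<mu> j)) = (\<Sum>j\<in>{n..<N}. 1 / ennreal (p j (Suc j) * F p j 0))"
        using n F_pos p_up_pos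
        by (intro sum.cong) (auto simp: \<mu>_def divide_ennreal simp flip: ennreal_1)
    qed (use n \<mu>_pos in \<open>auto intro: less_imp_le\<close>)
    also have "\<dots> \<le> (\<Sum>\<^sub>\<infinity>j\<in>{n..}. 1 / ennreal (p j (Suc j) * F p j 0))"
      by (rule sum_le_infsum_ennreal) auto
    finally have "ennreal (hsum p n) * ennreal (\<Sum>j\<in>{n..<N}. \<mu> j) \<le> ennreal S"
      using tail_ennreal[OF n] by (meson mult_left_mono order_trans zero_le)
    then show ?thesis
      using hsum_ge_1[OF n] S(2) by (simp flip: ennreal_mult')
  qed
  define s where "s j = \<mu> j * sqrt (hsum p j)" for j
  have s_pos: "0 < s j" if "1 \<le> j" for j
    using \<mu>_pos[OF that] hsum_ge_1[OF that] by (simp add: s_def)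
  have hardy: "(\<Sum>j\<in>{n..<N}. s j) \<le> 2 * S / sqrt (hsum p n)" if "1 \<le> n" for n N
    unfolding s_def
  proof (rule hardy_tail[OF _ _ _ tail that])
    show "0 < hsum p k" if "1 \<le> k" for k using hsum_ge_1[OF that] by simp
    show "hsum p k \<le> hsum p (Suc k)" for k using F_nonneg[of k 0] by (simp add: hsum_Suc)
  qed (use \<mu>_pos in \<open>auto intro: less_imp_le\<close>)
  have part: "(\<Sum>j<N. s (Suc n + j)) \<le> 2 * S / sqrt (hsum p (Suc n))" for n N
  proof -
    have "(\<Sum>j<N. s (Suc n + j)) = (\<Sum>j\<in>{Suc n..<Suc n + N}. s j)"
      by (rule sum.reindex_bij_witness[of _ "\<lambda>j. j - Suc n" "\<lambda>j. Suc n + j"]) auto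
    then show ?thesis using hardy[of "Suc n" "Suc n + N"] by (simp del: sum.op_ivl_Suc)
  qed
  have summ: "summable (\<lambda>j. s (Suc n + j))" for n
    by (rule summableI_nonneg_bounded[OF _ part]) (use s_pos in \<open>auto intro: less_imp_le\<close>)
  \<comment> \<open>The tail starts at \<open>Suc n\<close>, so the drop from
    \<open>w (n - 1)\<close> to \<open>w n\<close> is exactly \<open>s n\<close>.\<close>
  define w where "w n = (\<Sum>j. s (Suc n + j))" for n
  have w_le: "w n \<le> 2 * S / sqrt (hsum p (Suc n))" for n
    unfolding w_def by (rule suminf_le_const[OF summ part])
  have w_pos: "0 < w n" for n
    unfolding w_def by (rule suminf_pos[OF summ]) (simp add: s_pos)
  have w_Suc: "w n = s (Suc n) + w (Suc n)" for n
    using suminf_split_head[OF summ[of n]] by (simp add: w_def)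
  have w_anti: "w n \<le> w m" if "m \<le> n" for m n
    using that
  proof (rule lift_Suc_antimono_le[rotated])
    show "w (Suc k) \<le> w k" for k
      using w_Suc[of k] s_pos[of "Suc k"] by simp
  qed
  define f where "f n = (\<Sum>k<n. F p k 0 * w k)" for n
  have f_Suc: "f (Suc n) - f n = F p n 0 * w n" for n by (simp add: f_def)
  \<comment> \<open>Each increment is at most \<open>4 * S * (b - a)\<close>: factor F as
    \<open>(b - a) * (b + a)\<close>, bound \<open>w n\<close> by \<open>2 * S / b\<close>, and use
    \<open>b + a \<le> 2 * b\<close>.\<close>
  have f_le: "f n \<le> 4 * S * sqrt (hsum p n)" for n
  proof (induction n)
    case 0
    then show ?case by (simp add: f_def hsum_def)
  next
    case (Suc n)
    define a b where "a = sqrt (hsum p n)" and "b = sqrt (hsum p (Suc n))"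
    have "0 \<le> hsum p n"
      unfolding hsum_def by (intro sum_nonneg F_nonneg)
    then have ab: "0 \<le> a" "a \<le> b" "0 < b" "F p n 0 = b * b - a * a"
      using hsum_ge_1[of "Suc n"] F_nonneg[of n 0] by (auto simp: a_def b_def hsum_Suc)
    have "F p n 0 * w n \<le> F p n 0 * (2 * S / b)"
      using w_le[of n] F_nonneg[of n 0] by (intro mult_left_mono) (auto simp: b_def)
    also have "\<dots> = 2 * S * (b - a) * ((b + a) / b)"
      unfolding ab(4) using ab(3) by (simp add: field_simps)
    also have "\<dots> \<le> 2 * S * (b - a) * 2"
    proof (rule mult_left_mono)
      show "(b + a) / b \<le> 2" using ab(2,3) by (simp add: pos_divide_le_eq)
    qed (use ab S(2) in simp)
    finally show ?case
      using Suc f_Suc[of n] by (simp add: a_def b_def algebra_simps)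
  qed
  have S0: "0 < S"
    using w_le[of 0] w_pos[of 0] by (auto simp: hsum_def F_diag)
  \<comment> \<open>\<open>f\<close> is nondecreasing and \<open>f 1 = w 0\<close>, which gives the
    positive lower bound for \<open>geometric_drift\<close>.\<close>
  have f_ge: "w 0 \<le> f n" if "1 \<le> n" for n
    using that
  proof (induction n rule: dec_induct)
    case base
    then show ?case by (simp add: f_def F_diag)
  next
    case (step n)
    have "0 \<le> F p n 0 * w n" using F_nonneg[of n 0] w_pos[of n] by simp
    then show ?case using step f_Suc[of n] by linarith
  qed
  have drift_f: "(\<Sum>k\<in>{1..Suc n}. p n k * f k) \<le> f n - f n / (4 * S)" if n: "1 \<le> n" for n
  proof -
    obtain m where m: "n = Suc m" using n by (cases n) auto
    \<comment> \<open>Replacing each \<open>w j\<close>, \<open>j < n\<close>, by the smaller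
      \<open>w m\<close> lets \<open>F0_rec\<close> sum the weights. What remains is
      \<open>w n - w m = - s n\<close>, and \<open>\<mu> n\<close> cancels its prefactor.\<close>
    have "p n (Suc n) * F p n 0 * w m = (\<Sum>j<n. pcum p n j * F p j 0 * w m)"
      using F0_rec[OF n] by (simp add: sum_distrib_right)
    also have "\<dots> \<le> (\<Sum>j<n. pcum p n j * F p j 0 * w j)"
      by (intro sum_mono mult_left_mono w_anti mult_nonneg_nonneg pcum_nonneg F_nonneg)
        (use n m in auto)
    finally have "(\<Sum>k\<in>{1..Suc n}. p n k * f k) - f n \<le> p n (Suc n) * F p n 0 * (w n - w m)"
      using drift[OF n, of f] by (simp add: f_Suc) (simp add: f_def algebra_simps)
    also have "\<dots> = - sqrt (hsum p n)"
      using w_Suc[of m] F_pos[OF n] p_up_pos[OF n] by (simp add: m s_def \<mu>_def)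
    also have "\<dots> \<le> - f n / (4 * S)"
      using f_le[of n] S0 by (simp add: field_simps)
    finally show ?thesis by simp
  qed
  have "0 < 4 * S" using S0 by simp
  then obtain \<kappa> K :: real where \<kappa>: "1 < \<kappa>"
    and bd: "\<And>i. 1 \<le> i \<Longrightarrow> (\<Sum>\<^sub>\<infinity>n\<in>{1..}. ennreal (\<kappa> ^ n) * survival p n i) \<le> ennreal (K * f i)"
    using geometric_drift[OF f_ge w_pos _ drift_f] by metis
  have "(\<Sum>\<^sub>\<infinity>n\<in>{1..}. ennreal (\<kappa> ^ n) * survival p n i) < \<infinity>" if "1 \<le> i" for i
    using bd[OF that] by (rule le_less_trans) simp
  then show ?thesis
    unfolding strongly_geometric_transient_def using \<kappa> by blast
qed

end

theorem theorem4p9: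
  fixes p :: "nat \<Rightarrow> nat \<Rightarrow> real"
  assumes "substochastic p"
    and "irreducible_matrix p"
    and "\<And>i j. 1 \<le> i \<Longrightarrow> i + 2 \<le> j \<Longrightarrow> p i j = 0"
    and "\<exists>i\<ge>1. (\<Sum>\<^sub>\<infinity>j\<in>{1..}. p i j) < 1"
  shows "(sigma3 p < \<infinity> \<longrightarrow> strongly_geometric_transient p)
       \<and> (uniformly_geometric_transient p \<longleftrightarrow> sigma4 p < \<infinity>)"
proof -
  interpret single_birth p
    using assms(1-3) by unfold_locales
  show ?thesis
    using strongly_geometric_transient_if_sigma3 uniformly_geometric_transient_if_sigma4
      sigma4_if_uniformly_geometric_transient by blast
qed

end
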